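(* Let $n\ge 2$ be an integer, let $a_1,a_2,a_3,a_4\in\mathbb{C}$ be pairwise distinct, and put $\mathcal{H}(z)=(z-a_1)(z-a_2)(z-a_3)(z-a_4)$. Suppose that $\mathcal{T}_n$ is a complex polynomial of degree $n$ and $\mathcal{U}_{n-2}$ is a complex polynomial of degree $n-2$ such that $\mathcal{T}_n^2(z)-\mathcal{H}(z)\,\mathcal{U}_{n-2}^2(z)=1$. Let $z^*\in\mathbb{C}$ be the point defined by $\mathcal{T}_n'(z)=\pm n(z-z^* )\,\mathcal{U}_{n-2}(z)$. If $\mathcal{T}_n(z^* )\notin\{-1,1\}$, then $\mathcal{T}_n$ has exactly $n+2$ extremal points on $\mathcal{T}_n^{-1}([-1,1])$; if $\mathcal{T}_n(z^* )\in\{-1,1\}$, then $\mathcal{T}_n$ has exactly $n+1$ extremal points on $\mathcal{T}_n^{-1}([-1,1])$.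
   Context: $\mathcal{T}_n^{-1}([-1,1])=\{z\in\mathbb{C}:\mathcal{T}_n(z)\in[-1,1]\}$. A point $z_0\in\mathcal{T}_n^{-1}([-1,1])$ is called an extremal point of $\mathcal{T}_n$ on $\mathcal{T}_n^{-1}([-1,1])$ if $\mathcal{T}_n(z_0)\in\{-1,1\}$; extremal points are counted as distinct points of $\mathbb{C}$ (without multiplicity). The polynomial identity $\mathcal{T}_n^2-\mathcal{H}\,\mathcal{U}_{n-2}^2=1$ implies that $\mathcal{T}_n'$ is of the form $\pm n(z-z^* )\,\mathcal{U}_{n-2}(z)$ for a unique $z^*\in\mathbb{C}$ (and a suitable choice of sign); this defines $z^*$. *)

theory Defs
  imports Complex_Main "HOL-Computational_Algebra.Computational_Algebra"
begin

definition preimage_interval :: "complex poly \<Rightarrow> complex set" where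
  "preimage_interval T = {z. poly T z \<in> complex_of_real ` {-1..1}}"

definition extremal_points :: "complex poly \<Rightarrow> complex set" where
  "extremal_points T = {z \<in> preimage_interval T. poly T z \<in> {-1, 1}}"

definition is_z_star :: "nat \<Rightarrow> complex poly \<Rightarrow> complex poly \<Rightarrow> complex \<Rightarrow> bool" where
  "is_z_star n T U z \<longleftrightarrow>
     pderiv T = smult (of_nat n) ([:-z, 1:] * U) \<or>
     pderiv T = - smult (of_nat n) ([:-z, 1:] * U)"

definition z_star :: "nat \<Rightarrow> complex poly \<Rightarrow> complex poly \<Rightarrow> complex" where
  "z_star n T U = (THE z. is_z_star n T U z)"

text \<open>The definite description above is meaningful: for solutions of the polynomial identity
  the point exists and is unique. This does not need the roots of the quartic to be distinct.\<close>

lemma is_z_star_ex1: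
  fixes T U H :: "complex poly"
  assumes n: "n \<ge> 2" and degT: "degree T = n" and degU: "degree U = n - 2"
    and H: "H = [:-a1, 1:] * [:-a2, 1:] * [:-a3, 1:] * [:-a4, 1:]"
    and eq: "T ^ 2 - H * U ^ 2 = 1"
  shows "\<exists>!z. is_z_star n T U z"
proof -
  have T0: "T \<noteq> 0" using n degT by auto
  have H0: "H \<noteq> 0" by (simp add: H)
  have lcH: "lead_coeff H = 1" by (simp add: H lead_coeff_mult del: mult_pCons_left mult_pCons_right)
  have U0: "U \<noteq> 0"
  proof
    assume "U = 0"
    then have "T ^ 2 = 1" using eq by simp
    then have "degree (T ^ 2) = 0" by simp
    then show False using n degT T0 by (simp add: degree_power_eq)
  qed
  have T2: "T ^ 2 = H * U ^ 2 + 1" using eq by (simp add: algebra_simps)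
  have d: "degree (H * U ^ 2) = 2 * n"
  proof -
    have "degree H = 4" by (simp add: H degree_mult_eq del: mult_pCons_left mult_pCons_right)
    then show ?thesis using n degU H0 U0 by (simp add: degree_mult_eq degree_power_eq)
  qed
  have "lead_coeff (T ^ 2) = lead_coeff (H * U ^ 2)"
    using lead_coeff_add_le[of 1 "H * U ^ 2"] d n by (simp add: T2 add.commute)
  then have "(lead_coeff T)\<^sup>2 = (lead_coeff U)\<^sup>2"
    using lcH by (simp add: lead_coeff_power lead_coeff_mult)
  then have lc: "lead_coeff T = lead_coeff U \<or> lead_coeff T = - lead_coeff U"
    by (simp add: power2_eq_iff)
  have "pderiv (T ^ 2) = pderiv (H * U ^ 2)" by (simp add: T2 pderiv_add)
  then have TT: "2 * T * pderiv T = U * (pderiv H * U + 2 * H * pderiv U)"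
    by (simp add: power2_eq_square pderiv_mult algebra_simps)
  have "2 * pderiv T = 2 * pderiv T * (T ^ 2 - H * U ^ 2)" by (simp add: eq)
  also have "\<dots> = T * (2 * T * pderiv T) - 2 * pderiv T * H * U ^ 2"
    by (simp add: algebra_simps power2_eq_square)
  also have "\<dots> = U * (T * (pderiv H * U + 2 * H * pderiv U) - 2 * pderiv T * H * U)"
    unfolding TT by (simp add: algebra_simps power2_eq_square)
  finally have "U dvd 2 * pderiv T" by (rule dvdI)
  then have "U dvd smult 2 (pderiv T)" by (simp add: numeral_poly)
  then have "U dvd pderiv T" by (simp add: dvd_smult_iff)
  then obtain V where V: "pderiv T = V * U" by (metis dvdE mult.commute)
  have dT': "degree (pderiv T) = n - 1" using degT by (simp add: degree_pderiv)
  have T'0: "pderiv T \<noteq> 0" using degT n by (simp add: pderiv_eq_0_iff)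
  then have V0: "V \<noteq> 0" using V by auto
  have dV: "degree V = 1" using dT' V V0 U0 degU n by (simp add: degree_mult_eq)
  obtain b p where bp: "V = pCons b p" by (cases V)
  then have "degree p = 0" using dV by (cases "p = 0") auto
  then obtain c where "p = [:c:]" by (rule degree_eq_zeroE)
  then have Vbc: "V = [:b, c:]" and c0: "c \<noteq> 0" using bp dV by auto
  have "lead_coeff (pderiv T) = of_nat n * lead_coeff T"
    using n degT by (cases n) (auto simp: dT' coeff_pderiv degree_pderiv)
  moreover have "lead_coeff (pderiv T) = c * lead_coeff U"
    using c0 by (simp only: V lead_coeff_mult) (simp add: Vbc)
  ultimately have "c * lead_coeff U = of_nat n * lead_coeff U \<or>
      c * lead_coeff U = (- of_nat n) * lead_coeff U" using lc by auto
  then have c: "c = of_nat n \<or> c = - of_nat n"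
    using U0 by (simp only: mult_cancel_right leading_coeff_0_iff) blast
  have "smult c [:-(-b/c), 1:] = V" using c0 by (simp add: Vbc)
  then have "pderiv T = smult c ([:-(-b/c), 1:] * U)" using V by (metis mult_smult_left)
  then have ex: "is_z_star n T U (-b/c)"
    using c unfolding is_z_star_def by (metis smult_minus_left)
  show ?thesis
  proof (rule ex1I[of _ "-b/c"])
    show "is_z_star n T U (-b/c)" by (rule ex)
  next
    fix z assume "is_z_star n T U z"
    then obtain d where "pderiv T = smult d ([:-z, 1:] * U)"
      unfolding is_z_star_def by (metis smult_minus_left)
    then have "V * U = smult d [:-z, 1:] * U" using V by (metis mult_smult_left)
    then have "V = smult d [:-z, 1:]" using U0 by (metis mult_cancel_right)
    then show "z = -b/c" using c0 by (simp add: Vbc)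
  qed
qed

end

theory Submission
  imports Defs
begin

text \<open>The extremal points are the distinct zeros of \<open>T\<^sup>2 - 1 = H U\<^sup>2\<close>, a polynomial of degree
  \<open>2n\<close>. Its zeros counted without multiplicity are \<open>2n\<close> minus the total multiplicity they have as
  zeros of the derivative \<open>2 T T' = \<plusminus>2n T (z - z\<^sup>*) U\<close>. There \<open>T = \<plusminus>1\<close> contributes nothing, \<open>U\<close>
  contributes its degree \<open>n - 2\<close> because all its zeros are extremal points, and \<open>z - z\<^sup>*\<close>
  contributes 1 exactly if \<open>T(z\<^sup>*) = \<plusminus>1\<close>.\<close>

text \<open>Complex polynomials split into linear factors, and points of \<open>S\<close> that are
  not zeros have order 0. The larger set \<open>S\<close> allows the zeros of \<open>U\<close> to be
  summed over those of \<open>T ^ 2 - 1\<close>.\<close>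

lemma sum_order_eq_degree:
  fixes p :: "complex poly"
  assumes "p \<noteq> 0" "finite S" "{z. poly p z = 0} \<subseteq> S"
  shows "(\<Sum>z\<in>S. order z p) = degree p"
proof -
  have "degree p = (\<Sum>z\<in>{z. poly p z = 0}. order z p)"
    using assms(1) by (simp add: size_proots_complex[symmetric] size_multiset_overloaded_eq)
  also have "\<dots> = (\<Sum>z\<in>S. order z p)"
    using assms by (intro sum.mono_neutral_left) (auto simp: order_gt_0_iff)
  finally show ?thesis ..
qed

text \<open>In characteristic 0, differentiation lowers the order of each zero by exactly one, so
  the orders lost count the distinct zeros.\<close>

lemma card_roots_plus_order_pderiv:
  fixes p :: "complex poly"
  assumes "degree p > 0"
  shows "card {z. poly p z = 0} + (\<Sum>z | poly p z = 0. order z (pderiv p)) = degree p"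
proof -
  have p: "p \<noteq> 0" "pderiv p \<noteq> 0" using assms by (auto simp: pderiv_eq_0_iff)
  have "degree p = (\<Sum>z | poly p z = 0. order z p)"
    using p by (intro sum_order_eq_degree[symmetric]) (auto simp: poly_roots_finite)
  also have "\<dots> = (\<Sum>z | poly p z = 0. Suc (order z (pderiv p)))"
    using p by (intro sum.cong refl order_pderiv) auto
  finally show ?thesis using p by (simp add: sum.distrib poly_roots_finite sum_Suc)
qed

lemma order_linear_factor:
  fixes a z :: "'a :: idom"
  shows "order z [:- a, 1:] = (if z = a then 1 else 0)"
  using order_power_n_n[of a 1] by (auto intro!: order_0I)

lemma extremal_points_eq_roots: "extremal_points T = {z. poly (T ^ 2 - 1) z = 0}"
proof -
  have "1 \<in> complex_of_real ` {-1..1}" "-1 \<in> complex_of_real ` {-1..1}"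
    using imageI[of 1 "{-1..1}" complex_of_real] imageI[of "-1" "{-1..1}" complex_of_real] by auto
  then show ?thesis
    by (auto simp: extremal_points_def preimage_interval_def power2_eq_1_iff)
qed

theorem theorem1:
  fixes n :: nat and a1 a2 a3 a4 :: complex and H T U :: "complex poly"
  assumes "n \<ge> 2"
    and "distinct [a1, a2, a3, a4]"
    and "H = [:-a1, 1:] * [:-a2, 1:] * [:-a3, 1:] * [:-a4, 1:]"
    and "degree T = n"
    and "degree U = n - 2"
    and "T ^ 2 - H * U ^ 2 = 1"
  shows "(poly T (z_star n T U) \<notin> {-1, 1} \<longrightarrow> card (extremal_points T) = n + 2) \<and>
         (poly T (z_star n T U) \<in> {-1, 1} \<longrightarrow> card (extremal_points T) = n + 1)"
proof -
  define P where "P = T ^ 2 - 1"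
  define w where "w = z_star n T U"
  define E where "E = {z. poly P z = 0}"
  have "is_z_star n T U w"
    unfolding w_def z_star_def by (rule theI'[OF is_z_star_ex1[OF assms(1,4,5,3,6)]])
  \<comment> \<open>Here \<open>c\<close> is \<open>n\<close> or \<open>-n\<close>, which merges the
    two sign cases; it is nonzero because n \<ge> 2.\<close>
  then obtain c where c: "c \<noteq> 0" "pderiv T = smult c ([:- w, 1:] * U)"
    using assms(1) unfolding is_z_star_def
    by (metis less_numeral_extra(3) less_le_trans neg_equal_0_iff_equal of_nat_eq_0_iff
        smult_minus_left zero_less_numeral)
  have T0: "T \<noteq> 0" using assms(1,4) by auto
  have degP: "degree P = 2 * n"
    using assms(1,4) T0 degree_add_eq_left[of "- 1" "T ^ 2"] by (simp add: P_def degree_power_eq)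
  have P0: "P \<noteq> 0" using degP assms(1) by auto
  have fin: "finite E" using P0 by (simp add: E_def poly_roots_finite)
  have P_eq: "P = H * U ^ 2" using assms(6) by (simp add: P_def algebra_simps)
  have U0: "U \<noteq> 0" using P0 P_eq by auto
  have w_E: "w \<in> E \<longleftrightarrow> poly T w \<in> {-1, 1}"
    by (auto simp: E_def P_def power2_eq_1_iff)
  have ord: "order z (pderiv P) = order z [:- w, 1:] + order z U" if "z \<in> E" for z
  proof -
    have "pderiv P = smult (2 * c) (T * ([:- w, 1:] * U))"
      by (simp add: P_def power2_eq_square pderiv_diff pderiv_mult c(2) mult.commute
          flip: smult_add_left)
    \<comment> \<open>On \<open>E\<close> the square of \<open>T\<close> is 1, so the factor
      \<open>T\<close> adds nothing to the order.\<close>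
    moreover have "poly T z \<noteq> 0" using that by (auto simp: E_def P_def)
    ultimately show ?thesis
      using c(1) T0 U0 by (simp add: order_smult order_mult order_0I del: mult_pCons_left)
  qed
  have "2 * n = card E + (\<Sum>z\<in>E. order z (pderiv P))"
    using card_roots_plus_order_pderiv[of P] degP assms(1) by (simp add: E_def)
  also have "(\<Sum>z\<in>E. order z (pderiv P)) = (\<Sum>z\<in>E. order z [:- w, 1:]) + (\<Sum>z\<in>E. order z U)"
    using ord by (simp add: sum.distrib)
  also have "(\<Sum>z\<in>E. order z U) = n - 2"
    using sum_order_eq_degree[of U E] U0 fin assms(5) by (auto simp: E_def P_eq)
  also have "(\<Sum>z\<in>E. order z [:- w, 1:]) = (if w \<in> E then 1 else 0)"
    using fin by (simp add: order_linear_factor)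
  \<comment> \<open>The truncated difference \<open>n - 2\<close> is a true one since n \<ge> 2, so
    2n - (n - 2) = n + 2.\<close>
  finally have "card E + (if w \<in> E then 1 else 0) = n + 2"
    using assms(1) by auto
  moreover have "extremal_points T = E"
    by (simp add: extremal_points_eq_roots E_def P_def)
  ultimately show ?thesis
    using w_E by (auto simp flip: w_def split: if_splits)
qed

end
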